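(* Let $A,B\in\mathcal{B}(\mathcal{H})$ be two strictly positive operators on a complex Hilbert space $\mathcal{H}$. If $0<t\le s\le 1$, then $$T_t(A|B)\le T_s(A|B).$$
   Context: $\mathcal{B}(\mathcal{H})$ is the algebra of bounded linear operators on $\mathcal{H}$; an operator is strictly positive if it is positive and invertible; $\le$ is the usual order on self-adjoint operators. For strictly positive $A,B$ and $0<t\le 1$, the Tsallis relative operator entropy is $$T_t(A|B)=A^{1/2}\ln_t\left(A^{-1/2}BA^{-1/2}\right)A^{1/2}=\frac{A\sharp_tB-A}{t},$$ where $\ln_tx=\frac{x^t-1}{t}$ for $x>0$ and $A\sharp_tB=A^{1/2}(A^{-1/2}BA^{-1/2})^tA^{1/2}$. *)

theory Defs
  imports "HOL-Analysis.Analysis" "HOL-Computational_Algebra.Polynomial"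
begin

section \<open>Complex Hilbert spaces\<close>

class complex_vector = real_vector +
  fixes scaleC :: "complex \<Rightarrow> 'a \<Rightarrow> 'a" (infixr \<open>*\<^sub>C\<close> 75)
  assumes scaleC_add_right: "a *\<^sub>C (x + y) = a *\<^sub>C x + a *\<^sub>C y"
    and scaleC_add_left: "(a + b) *\<^sub>C x = a *\<^sub>C x + b *\<^sub>C x"
    and scaleC_scaleC: "a *\<^sub>C (b *\<^sub>C x) = (a * b) *\<^sub>C x"
    and scaleR_scaleC: "r *\<^sub>R x = complex_of_real r *\<^sub>C x"

text \<open>
  A complex inner product determines a real one by taking real parts. Building on
  \<^class>\<open>real_inner\<close> therefore does not restrict the spaces considered: it supplies the norm,
  the topology and, since \<open>\<langle>x, x\<rangle>\<close> is real by conjugate symmetry, positive definiteness.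
  The inner product is linear in its first argument.
\<close>

class complex_inner = complex_vector + real_inner +
  fixes cinner :: "'a \<Rightarrow> 'a \<Rightarrow> complex"
  assumes cinner_commute: "cinner x y = cnj (cinner y x)"
    and cinner_add_left: "cinner (x + y) z = cinner x z + cinner y z"
    and cinner_scaleC_left: "cinner (c *\<^sub>C x) y = c * cinner x y"
    and inner_eq_Re_cinner: "inner x y = Re (cinner x y)"

class complex_hilbert = complex_inner + complete_space


section \<open>The algebra of bounded operators\<close>

typedef (overloaded) 'a bop =
  "{f :: 'a::complex_hilbert \<Rightarrow> 'a. bounded_linear f \<and> (\<forall>c x. f (c *\<^sub>C x) = c *\<^sub>C f x)}"
  morphisms bop_apply Bop
  by (rule exI[of _ "\<lambda>x. x"]) (auto intro: bounded_linear_ident)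

setup_lifting type_definition_bop

lemma scaleC_zero_right: "c *\<^sub>C (0 :: 'a::complex_vector) = 0"
  using scaleC_add_right[of c "0::'a" 0] by simp

lemma scaleC_minus_right: "c *\<^sub>C (- x) = - (c *\<^sub>C x)" for x :: "'a::complex_vector"
  using scaleC_add_right[of c x "- x"]
  by (simp add: scaleC_zero_right eq_neg_iff_add_eq_0 add.commute)

lemma scaleC_diff_right: "c *\<^sub>C (x - y) = c *\<^sub>C x - c *\<^sub>C y" for x :: "'a::complex_vector"
  using scaleC_add_right[of c x "- y"] by (simp add: scaleC_minus_right)

lemma scaleC_scaleR_commute: "c *\<^sub>C (r *\<^sub>R x) = r *\<^sub>R (c *\<^sub>C x)" for x :: "'a::complex_vector"
  by (simp add: scaleR_scaleC scaleC_scaleC mult.commute)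

lemma norm_scaleC: "norm (c *\<^sub>C x) = cmod c * norm x" for x :: "'a::complex_inner"
proof -
  have "cinner (c *\<^sub>C x) (c *\<^sub>C x) = c * cnj (c * cinner x x)"
    by (metis cinner_commute cinner_scaleC_left)
  also have "cnj (c * cinner x x) = cnj c * cinner x x"
    by (metis cinner_commute complex_cnj_mult)
  also have "c * (cnj c * cinner x x) = complex_of_real ((cmod c)\<^sup>2) * cinner x x"
    by (metis complex_norm_square mult.assoc of_real_power)
  finally have "inner (c *\<^sub>C x) (c *\<^sub>C x) = (cmod c)\<^sup>2 * inner x x"
    by (simp add: inner_eq_Re_cinner)
  then show ?thesis
    by (simp add: norm_eq_sqrt_inner real_sqrt_mult)
qed

lemma bounded_linear_scaleC: "bounded_linear (\<lambda>x :: 'a::complex_inner. c *\<^sub>C x)"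
  by (rule bounded_linear_intro[where K = "cmod c"])
    (simp_all add: scaleC_add_right scaleC_scaleR_commute norm_scaleC mult.commute)

instantiation bop :: (complex_hilbert) real_normed_vector
begin

lift_definition norm_bop :: "'a bop \<Rightarrow> real" is onorm .

lift_definition zero_bop :: "'a bop" is "\<lambda>x. 0"
  by (simp add: scaleC_zero_right bounded_linear_zero)

lift_definition plus_bop :: "'a bop \<Rightarrow> 'a bop \<Rightarrow> 'a bop" is "\<lambda>f g x. f x + g x"
  by (simp add: scaleC_add_right bounded_linear_add)

lift_definition minus_bop :: "'a bop \<Rightarrow> 'a bop \<Rightarrow> 'a bop" is "\<lambda>f g x. f x - g x"
  by (simp add: scaleC_diff_right bounded_linear_sub)

lift_definition uminus_bop :: "'a bop \<Rightarrow> 'a bop" is "\<lambda>f x. - f x"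
  by (simp add: scaleC_minus_right bounded_linear_minus)

lift_definition scaleR_bop :: "real \<Rightarrow> 'a bop \<Rightarrow> 'a bop" is "\<lambda>r f x. r *\<^sub>R f x"
  by (simp add: scaleC_scaleR_commute bounded_linear_const_scaleR)

definition dist_bop :: "'a bop \<Rightarrow> 'a bop \<Rightarrow> real"
  where "dist_bop a b = norm (a - b)"

definition sgn_bop :: "'a bop \<Rightarrow> 'a bop"
  where "sgn_bop x = inverse (norm x) *\<^sub>R x"

definition uniformity_bop :: "('a bop \<times> 'a bop) filter"
  where "uniformity_bop = (INF e\<in>{0 <..}. principal {(x, y). dist x y < e})"

definition open_bop :: "'a bop set \<Rightarrow> bool"
  where "open_bop S = (\<forall>x\<in>S. \<forall>\<^sub>F (x', y) in uniformity. x' = x \<longrightarrow> y \<in> S)"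

instance
  apply standard
  unfolding dist_bop_def open_bop_def sgn_bop_def uniformity_bop_def
  apply (rule refl | (transfer, force simp: onorm_triangle onorm_scaleR onorm_eq_0 algebra_simps))+
  done

end

instantiation bop :: (complex_hilbert) complex_vector
begin

lift_definition scaleC_bop :: "complex \<Rightarrow> 'a bop \<Rightarrow> 'a bop" is "\<lambda>c f x. c *\<^sub>C f x"
  by (auto intro: bounded_linear_compose[OF bounded_linear_scaleC]
      simp: scaleC_scaleC mult.commute)

instance
  by standard (transfer; simp add: scaleC_add_right scaleC_add_left scaleC_scaleC scaleR_scaleC)+

end

text \<open>
  Multiplication is composition. The class \<open>real_normed_algebra_1\<close> is not available because
  it would exclude the zero space.
\<close>

instantiation bop :: (complex_hilbert) "{real_normed_algebra, monoid_mult}"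
begin

lift_definition times_bop :: "'a bop \<Rightarrow> 'a bop \<Rightarrow> 'a bop" is "\<lambda>f g x. f (g x)"
  by (auto intro: bounded_linear_compose)

lift_definition one_bop :: "'a bop" is "\<lambda>x. x"
  by (simp add: bounded_linear_ident)

instance
proof
  fix a b c :: "'a bop" and r :: real
  show "a * b * c = a * (b * c)" by transfer simp
  show "(a + b) * c = a * c + b * c" by transfer simp
  show "a * (b + c) = a * b + a * c"
    by transfer (simp add: linear_add bounded_linear.linear)
  show "r *\<^sub>R a * b = r *\<^sub>R (a * b)" by transfer simp
  show "a * r *\<^sub>R b = r *\<^sub>R (a * b)"
    by transfer (simp add: linear_cmul bounded_linear.linear)
  show "norm (a * b) \<le> norm a * norm b"
    by transfer (auto dest: onorm_compose simp: o_def)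
  show "1 * a = a" by transfer simp
  show "a * 1 = a" by transfer simp
qed

end

definition invertible_op :: "'a::complex_hilbert bop \<Rightarrow> bool"
  where "invertible_op X \<longleftrightarrow> (\<exists>Y. X * Y = 1 \<and> Y * X = 1)"

definition selfadjoint_op :: "'a::complex_hilbert bop \<Rightarrow> bool"
  where "selfadjoint_op X \<longleftrightarrow> (\<forall>x y. cinner (bop_apply X x) y = cinner x (bop_apply X y))"

definition positive_op :: "'a::complex_hilbert bop \<Rightarrow> bool"
  where "positive_op X \<longleftrightarrow> (\<forall>x. cinner (bop_apply X x) x \<in> \<real>\<^sub>\<ge>\<^sub>0)"

definition strictly_positive_op :: "'a::complex_hilbert bop \<Rightarrow> bool"
  where "strictly_positive_op X \<longleftrightarrow> positive_op X \<and> invertible_op X"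

definition le_op :: "'a::complex_hilbert bop \<Rightarrow> 'a bop \<Rightarrow> bool" (infix \<open>\<preceq>\<close> 50)
  where "X \<preceq> Y \<longleftrightarrow> selfadjoint_op X \<and> selfadjoint_op Y \<and> positive_op (Y - X)"


section \<open>Continuous functional calculus\<close>

definition spectrum_op :: "'a::complex_hilbert bop \<Rightarrow> complex set"
  where "spectrum_op X = {z. \<not> invertible_op (X - z *\<^sub>C 1)}"

definition poly_op :: "real poly \<Rightarrow> 'a::complex_hilbert bop \<Rightarrow> 'a bop"
  where "poly_op p X = (\<Sum>i\<le>degree p. coeff p i *\<^sub>R X ^ i)"

text \<open>
  For self-adjoint \<open>X\<close>, whose spectrum is real, and a real function \<open>f\<close> continuous on the
  spectrum, \<open>f(X)\<close> is the norm limit of \<open>p\<^sub>n(X)\<close> for any real polynomials \<open>p\<^sub>n\<close> converging to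
  \<open>f\<close> uniformly on the spectrum. The definition is meant for this situation only.
\<close>

definition fun_op :: "(real \<Rightarrow> real) \<Rightarrow> 'a::complex_hilbert bop \<Rightarrow> 'a bop"
  where "fun_op f X = (THE Y. \<exists>p. uniform_limit {r. complex_of_real r \<in> spectrum_op X}
      (\<lambda>n. poly (p n)) f sequentially \<and> (\<lambda>n. poly_op (p n) X) \<longlonglongrightarrow> Y)"

definition powr_op :: "'a::complex_hilbert bop \<Rightarrow> real \<Rightarrow> 'a bop"
  where "powr_op X a = fun_op (\<lambda>x. x powr a) X"


section \<open>Tsallis relative operator entropy\<close>

definition ln_tsallis :: "real \<Rightarrow> real \<Rightarrow> real"
  where "ln_tsallis t x = (x powr t - 1) / t"

definition tsallis_entropy :: "real \<Rightarrow> 'a::complex_hilbert bop \<Rightarrow> 'a bop \<Rightarrow> 'a bop"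
  where "tsallis_entropy t A B =
    powr_op A (1/2) * fun_op (ln_tsallis t) (powr_op A (- (1/2)) * B * powr_op A (- (1/2)))
      * powr_op A (1/2)"

end

theory Submission
  imports Defs "HOL-Computational_Algebra.Fundamental_Theorem_Algebra"
begin

text \<open>
  For fixed \<open>x > 0\<close> the number \<open>ln\<^sub>t x\<close> is increasing in \<open>t\<close> by Young's inequality. The functional
  calculus is monotone, which gives the inequality for \<open>C = A\<^sup>-\<^sup>1\<^sup>/\<^sup>2 B A\<^sup>-\<^sup>1\<^sup>/\<^sup>2\<close>, and multiplying by
  \<open>A\<^sup>1\<^sup>/\<^sup>2\<close> on both sides preserves the order. Everything about the functional calculus rests on
  \<open>\<parallel>q(X)\<parallel> \<le> sup \<bar>q\<bar>\<close> over the spectrum, for \<open>X\<close> self-adjoint and \<open>q\<close> a real polynomial: one of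
  \<open>\<plusminus> \<parallel>q(X)\<parallel>\<close> is a spectral value of \<open>q(X)\<close>, and spectral values of \<open>q(X)\<close> are values of \<open>q\<close> on
  the spectrum of \<open>X\<close>.
\<close>

\<comment> \<open>With values in a Banach space the bounded real-linear maps are complete, which
  yields the completeness of \<open>bop\<close> below.\<close>
subclass (in complex_hilbert) banach ..

section \<open>Bounded operators\<close>

lemma scaleC_one [simp]: "1 *\<^sub>C x = x" for x :: "'a::complex_vector"
  using scaleR_scaleC[of 1 x] by simp

lemma scaleC_zero_left [simp]: "0 *\<^sub>C x = 0" for x :: "'a::complex_vector"
  using scaleR_scaleC[of 0 x] by simp

lemma scaleC_minus_left: "(- c) *\<^sub>C x = - (c *\<^sub>C x)" for x :: "'a::complex_vector"
  using scaleC_add_left[of c "- c" x] by (simp add: eq_neg_iff_add_eq_0 add.commute)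

lemma cinner_scaleC_right: "cinner x (c *\<^sub>C y) = cnj c * cinner x y"
  by (metis cinner_commute cinner_scaleC_left complex_cnj_mult)

lemma cinner_self: "cinner x x = complex_of_real ((norm x)\<^sup>2)"
proof -
  have "cinner x x = cnj (cinner x x)" by (rule cinner_commute)
  then have "Im (cinner x x) = 0" by (simp add: complex_eq_iff)
  then show ?thesis by (simp add: complex_eq_iff power2_norm_eq_inner inner_eq_Re_cinner)
qed

lemma bop_eqI: "(\<And>x. bop_apply X x = bop_apply Y x) \<Longrightarrow> X = Y"
  by (simp add: bop_apply_inject[symmetric] fun_eq_iff)

lemmas bop_apply_simps [simp] =
  zero_bop.rep_eq plus_bop.rep_eq minus_bop.rep_eq uminus_bop.rep_eq scaleR_bop.rep_eq
  scaleC_bop.rep_eq times_bop.rep_eq one_bop.rep_eq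

lemma bounded_linear_bop_apply: "bounded_linear (bop_apply X)"
  using bop_apply[of X] by simp

lemma bop_apply_scaleC: "bop_apply X (c *\<^sub>C x) = c *\<^sub>C bop_apply X x"
  using bop_apply[of X] by simp

lemma linear_bop_apply: "linear (bop_apply X)"
  by (simp add: bounded_linear.linear bounded_linear_bop_apply)

lemmas bop_apply_linear [simp] = linear_add[OF linear_bop_apply] linear_diff[OF linear_bop_apply]
  linear_0[OF linear_bop_apply] linear_cmul[OF linear_bop_apply] bop_apply_scaleC

lemma norm_bop_apply_le: "norm (bop_apply X x) \<le> norm X * norm x"
  by (simp add: norm_bop.rep_eq onorm bounded_linear_bop_apply)

lemma norm_bop_leI: "(\<And>x. norm (bop_apply X x) \<le> b * norm x) \<Longrightarrow> 0 \<le> b \<Longrightarrow> norm X \<le> b"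
  by (simp add: norm_bop.rep_eq onorm_bound)

lemma scaleC_times_left: "(c *\<^sub>C X) * Y = c *\<^sub>C (X * Y)" for X Y :: "'a::complex_hilbert bop"
  by (rule bop_eqI) simp

lemma scaleC_times_right: "X * (c *\<^sub>C Y) = c *\<^sub>C (X * Y)" for X Y :: "'a::complex_hilbert bop"
  by (rule bop_eqI) simp

lemma bounded_linear_bop_eval: "bounded_linear (\<lambda>X. bop_apply X x)"
  by (rule bounded_linear_intro[where K = "norm x"])
    (simp_all add: norm_bop_apply_le mult.commute[of "norm x"])

lemma tendsto_bop_apply: "X \<longlonglongrightarrow> Y \<Longrightarrow> (\<lambda>n. bop_apply (X n) x) \<longlonglongrightarrow> bop_apply Y x"
  by (rule bounded_linear.tendsto[OF bounded_linear_bop_eval])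

lemma tendsto_scaleC: "X \<longlonglongrightarrow> y \<Longrightarrow> (\<lambda>n. c *\<^sub>C X n) \<longlonglongrightarrow> c *\<^sub>C y"
  for y :: "'a::complex_inner"
  by (rule bounded_linear.tendsto[OF bounded_linear_scaleC])

text \<open>Completeness is inherited from the bounded real-linear maps: the limit there commutes
  with complex scalars because all terms of the sequence do.\<close>

instance bop :: (complex_hilbert) banach
proof
  fix X :: "nat \<Rightarrow> 'a bop"
  assume "Cauchy X"
  define F where "F n = Blinfun (bop_apply (X n))" for n
  have apply_F: "blinfun_apply (F n) = bop_apply (X n)" for n
    by (simp add: F_def bounded_linear_Blinfun_apply bounded_linear_bop_apply)
  have dist_F: "dist (F m) (F n) = dist (X m) (X n)" for m n
    by (simp add: dist_norm norm_blinfun.rep_eq norm_bop.rep_eq minus_blinfun.rep_eq apply_F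
        minus_bop.rep_eq[abs_def])
  have "Cauchy F"
    using \<open>Cauchy X\<close> by (simp add: Cauchy_def dist_F)
  then obtain G where G: "F \<longlonglongrightarrow> G"
    using Cauchy_convergent_iff convergent_def by blast
  have lim: "(\<lambda>n. bop_apply (X n) x) \<longlonglongrightarrow> blinfun_apply G x" for x
    using blinfun.tendsto[OF G tendsto_const[of x]] by (simp add: apply_F)
  have "blinfun_apply G (c *\<^sub>C x) = c *\<^sub>C blinfun_apply G x" for c x
  proof (rule LIMSEQ_unique)
    show "(\<lambda>n. bop_apply (X n) (c *\<^sub>C x)) \<longlonglongrightarrow> blinfun_apply G (c *\<^sub>C x)" by (rule lim)
    show "(\<lambda>n. bop_apply (X n) (c *\<^sub>C x)) \<longlonglongrightarrow> c *\<^sub>C blinfun_apply G x"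
      using tendsto_scaleC[OF lim] by simp
  qed
  then have apply_Y: "bop_apply (Bop (blinfun_apply G)) = blinfun_apply G"
    by (intro Bop_inverse) (simp add: blinfun.bounded_linear_right)
  have "dist (X n) (Bop (blinfun_apply G)) = dist (F n) G" for n
    by (simp add: dist_norm norm_blinfun.rep_eq norm_bop.rep_eq minus_blinfun.rep_eq apply_F
        minus_bop.rep_eq[abs_def] apply_Y)
  then have "X \<longlonglongrightarrow> Bop (blinfun_apply G)"
    using G by (subst tendsto_dist_iff, subst (asm) tendsto_dist_iff) simp
  then show "convergent X" by (auto simp: convergent_def)
qed

section \<open>Invertibility of bounded operators\<close>

lemma invertible_op_times: "invertible_op X \<Longrightarrow> invertible_op Y \<Longrightarrow> invertible_op (X * Y)"
  unfolding invertible_op_def by (metis mult.assoc mult_1_left)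

lemma invertible_op_scaleC:
  assumes "c \<noteq> 0"
  shows "invertible_op (c *\<^sub>C X) \<longleftrightarrow> invertible_op X"
proof -
  have *: "invertible_op (d *\<^sub>C Y)" if "d \<noteq> 0" "invertible_op Y" for d and Y :: "'a bop"
  proof -
    obtain Z where "Y * Z = 1" "Z * Y = 1" using \<open>invertible_op Y\<close> by (auto simp: invertible_op_def)
    then show ?thesis
      unfolding invertible_op_def using \<open>d \<noteq> 0\<close>
      by (intro exI[of _ "inverse d *\<^sub>C Z"])
        (simp add: scaleC_times_left scaleC_times_right scaleC_scaleC)
  qed
  show ?thesis
    using *[of c X] *[of "inverse c" "c *\<^sub>C X"] assms by (auto simp: scaleC_scaleC)
qed

text \<open>For small \<open>\<tau> > 0\<close> the map \<open>u \<mapsto> u - \<tau> (X u - y)\<close> is a contraction; its fixed point solves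
  \<open>X u = y\<close>.\<close>

lemma coercive_invertible:
  fixes X :: "'a::complex_hilbert bop"
  assumes "m > 0" and coercive: "\<And>x. inner (bop_apply X x) x \<ge> m * (norm x)\<^sup>2"
  shows "invertible_op X"
proof -
  \<comment> \<open>The maximum with \<open>m\<close> secures \<open>K > 0\<close> and
    \<open>m \<le> K\<close> on the zero space as well, where \<open>norm X\<close> is 0.\<close>
  define K where "K = max (norm X) m"
  have "K > 0" "m \<le> K" and K: "norm (bop_apply X x) \<le> K * norm x" for x
    using \<open>m > 0\<close> norm_bop_apply_le[of X x]
    by (auto simp: K_def intro: order_trans[OF _ mult_right_mono])
  \<comment> \<open>This value minimizes
    \<open>1 - 2 * \<tau> * m + \<tau>\<^sup>2 * K\<^sup>2\<close>, which bounds the square of the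
    contraction factor; \<open>c\<close> is the root of the minimum.\<close>
  define \<tau> where "\<tau> = m / K\<^sup>2"
  define c where "c = sqrt (1 - m\<^sup>2 / K\<^sup>2)"
  have "\<tau> > 0" using \<open>m > 0\<close> \<open>K > 0\<close> by (simp add: \<tau>_def)
  have mK: "0 < m\<^sup>2 / K\<^sup>2" "m\<^sup>2 / K\<^sup>2 \<le> 1"
    using \<open>m > 0\<close> \<open>m \<le> K\<close> \<open>K > 0\<close> by (auto simp: power_mono)
  then have "0 \<le> c" "c < 1" by (simp_all add: c_def)
  have contr: "norm (x - \<tau> *\<^sub>R bop_apply X x) \<le> c * norm x" for x
  proof (rule power2_le_imp_le)
    have "(norm (x - \<tau> *\<^sub>R bop_apply X x))\<^sup>2
        = (norm x)\<^sup>2 - 2 * \<tau> * inner (bop_apply X x) x + \<tau>\<^sup>2 * (norm (bop_apply X x))\<^sup>2"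
      unfolding power2_norm_eq_inner
      by (simp add: inner_diff_left inner_diff_right inner_commute power2_eq_square algebra_simps)
    also have "\<dots> \<le> (norm x)\<^sup>2 - 2 * \<tau> * (m * (norm x)\<^sup>2) + \<tau>\<^sup>2 * (K * norm x)\<^sup>2"
      using coercive[of x] K[of x] \<open>\<tau> > 0\<close>
      by (intro add_mono diff_mono mult_left_mono power_mono) auto
    also have "\<dots> = (1 - m\<^sup>2 / K\<^sup>2) * (norm x)\<^sup>2"
      using \<open>K > 0\<close> by (simp add: \<tau>_def power2_eq_square field_simps)
    also have "\<dots> = (c * norm x)\<^sup>2"
      using mK by (simp add: c_def power_mult_distrib)
    finally show "(norm (x - \<tau> *\<^sub>R bop_apply X x))\<^sup>2 \<le> (c * norm x)\<^sup>2" .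
  qed (use \<open>0 \<le> c\<close> in simp)
  have ex1: "\<exists>!x. bop_apply X x = y" for y
  proof -
    define g where "g x = x - \<tau> *\<^sub>R (bop_apply X x - y)" for x
    have "dist (g u) (g v) \<le> c * dist u v" for u v
      using contr[of "u - v"] by (simp add: dist_norm g_def algebra_simps)
    then have "\<exists>!x. g x = x"
      using \<open>0 \<le> c\<close> \<open>c < 1\<close> by (intro banach_fix_type) auto
    then show ?thesis using \<open>\<tau> > 0\<close> by (simp add: g_def)
  qed
  define h where "h y = (THE x. bop_apply X x = y)" for y
  have Xh: "bop_apply X (h y) = y" for y unfolding h_def by (rule theI'[OF ex1])
  have hI: "h y = x" if "bop_apply X x = y" for x y using ex1[of y] Xh[of y] that by blast
  \<comment> \<open>Coercivity at \<open>h y\<close> and the Cauchy-Schwarz inequality bound the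
    inverse map.\<close>
  have h_bound: "norm (h y) \<le> norm y * (1 / m)" for y
  proof (cases "h y = 0")
    case False
    have "m * (norm (h y))\<^sup>2 \<le> norm y * norm (h y)"
      using coercive[of "h y"] norm_cauchy_schwarz[of y "h y"] by (simp add: Xh)
    then show ?thesis using False \<open>m > 0\<close> by (simp add: power2_eq_square field_simps)
  qed (use \<open>m > 0\<close> in simp)
  have "bounded_linear h"
    by (rule bounded_linear_intro[OF _ _ h_bound]) (auto intro!: hI simp: Xh)
  moreover have "h (c *\<^sub>C x) = c *\<^sub>C h x" for c x
    by (auto intro!: hI simp: Xh)
  ultimately have "bop_apply (Bop h) = h"
    by (intro Bop_inverse) simp
  then show ?thesis
    unfolding invertible_op_def
    by (intro exI[of _ "Bop h"] conjI bop_eqI) (simp_all add: Xh hI)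
qed

section \<open>Self-adjoint operators\<close>

lemma selfadjoint_inner:
  "selfadjoint_op X \<Longrightarrow> inner (bop_apply X x) y = inner x (bop_apply X y)"
  by (simp add: inner_eq_Re_cinner selfadjoint_op_def)

lemma cinner_add_right: "cinner x (y + z) = cinner x y + cinner x z"
  by (metis cinner_add_left cinner_commute complex_cnj_add)

lemma cinner_minus_left: "cinner (- x) y = - cinner x y"
  using cinner_scaleC_left[of "-1" x y] by (simp add: scaleC_minus_left)

lemma cinner_diff_left: "cinner (x - y) z = cinner x z - cinner y z"
  using cinner_add_left[of x "- y" z] by (simp add: cinner_minus_left)

text \<open>The product is conjugate linear in its second argument, so the imaginary part is the
  real part taken at \<open>\<i> *\<^sub>C y\<close>. This allows most computations to be done with
  \<open>inner\<close>.\<close>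

lemma cinner_eq_inner: "cinner x y = Complex (inner x y) (inner x (\<i> *\<^sub>C y))"
  by (simp add: complex_eq_iff inner_eq_Re_cinner cinner_scaleC_right)

lemma selfadjoint_iff_inner:
  "selfadjoint_op X \<longleftrightarrow> (\<forall>x y. inner (bop_apply X x) y = inner x (bop_apply X y))"
  by (auto simp: selfadjoint_inner) (simp add: selfadjoint_op_def cinner_eq_inner flip: bop_apply_scaleC)

lemma positive_op_iff:
  assumes "selfadjoint_op X"
  shows "positive_op X \<longleftrightarrow> (\<forall>x. 0 \<le> inner (bop_apply X x) x)"
proof -
  have "Im (cinner (bop_apply X x) x) = 0" for x
  proof -
    have "cinner (bop_apply X x) x = cnj (cinner (bop_apply X x) x)"
      by (metis assms cinner_commute selfadjoint_op_def)
    then show ?thesis by (simp add: complex_eq_iff)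
  qed
  then show ?thesis
    by (auto simp: positive_op_def complex_nonneg_Reals_iff inner_eq_Re_cinner)
qed

text \<open>Polarization: on a complex space a real quadratic form forces symmetry.\<close>

lemma positive_op_selfadjoint:
  fixes X :: "'a::complex_hilbert bop"
  assumes "positive_op X"
  shows "selfadjoint_op X"
proof -
  have im: "Im (cinner (bop_apply X x) x) = 0" for x
    using assms by (auto simp: positive_op_def complex_nonneg_Reals_iff)
  \<comment> \<open>At \<open>x + \<i> *\<^sub>C y\<close> the cross terms contribute Re<Xy,x> -
    Re<Xx,y> to the imaginary part, and all the other terms are real.\<close>
  have "inner (bop_apply X x) y = inner x (bop_apply X y)" for x y
    using im[of "x + \<i> *\<^sub>C y"] im[of x] im[of y]
    by (simp add: cinner_add_left cinner_add_right cinner_scaleC_left cinner_scaleC_right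
        inner_eq_Re_cinner cinner_commute[of x "bop_apply X y"])
  then show ?thesis by (simp add: selfadjoint_iff_inner)
qed

lemma strictly_positive_selfadjoint: "strictly_positive_op X \<Longrightarrow> selfadjoint_op X"
  by (simp add: strictly_positive_op_def positive_op_selfadjoint)

section \<open>Location of the spectrum\<close>

lemma selfadjoint_spectrum_real:
  assumes "selfadjoint_op X" "z \<in> spectrum_op X"
  shows "Im z = 0"
proof (rule ccontr)
  assume "Im z \<noteq> 0"
  \<comment> \<open>This unit rotates X - z so that the real part of its quadratic form becomes |Im
    z| times the squared norm, which is coercive.\<close>
  define c where "c = complex_of_real (sgn (Im z)) * \<i>"
  have "c \<noteq> 0" using \<open>Im z \<noteq> 0\<close> by (simp add: c_def sgn_eq_0_iff)
  have "invertible_op (c *\<^sub>C (X - z *\<^sub>C 1))"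
  proof (rule coercive_invertible[of "\<bar>Im z\<bar>"])
    fix x
    have "cinner (bop_apply X x) x = cnj (cinner (bop_apply X x) x)"
      by (metis assms(1) cinner_commute selfadjoint_op_def)
    then have "Im (cinner (bop_apply X x) x) = 0" by (simp add: complex_eq_iff)
    then show "\<bar>Im z\<bar> * (norm x)\<^sup>2 \<le> inner (bop_apply (c *\<^sub>C (X - z *\<^sub>C 1)) x) x"
      by (simp add: inner_eq_Re_cinner cinner_scaleC_left cinner_diff_left cinner_self c_def
          abs_sgn)
  qed (use \<open>Im z \<noteq> 0\<close> in simp)
  then show False
    using assms(2) \<open>c \<noteq> 0\<close> by (simp add: spectrum_op_def invertible_op_scaleC)
qed

text \<open>With M the norm of Y, suppose Y - M and Y + M are both invertible. Then |(Y^2 - M^2)x|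
  is bounded below by a multiple of |x|. But its square is at most M^2 (M^2 |x|^2 - |Yx|^2), so |Yx|
  \<le> b|x| for all x with a constant b < M, a contradiction.\<close>

lemma norm_mem_spectrum:
  assumes "selfadjoint_op Y" "norm Y > 0"
  shows "complex_of_real (norm Y) \<in> spectrum_op Y \<or> complex_of_real (- norm Y) \<in> spectrum_op Y"
proof (rule ccontr)
  define M where "M = norm Y"
  assume "\<not> ?thesis"
  then have "invertible_op ((Y - complex_of_real M *\<^sub>C 1) * (Y - complex_of_real (- M) *\<^sub>C 1))"
    by (intro invertible_op_times) (simp_all add: spectrum_op_def M_def)
  then obtain Z where Z: "Z * ((Y - M *\<^sub>R 1) * (Y + M *\<^sub>R 1)) = 1"
    by (auto simp: invertible_op_def scaleR_scaleC scaleC_minus_left)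
  define K where "K = norm Z + 1"
  have "K > 0" "norm Z \<le> K" by (auto simp: K_def add_nonneg_pos)
  have "M > 0" using assms by (simp add: M_def)
  have bound: "(norm x)\<^sup>2 \<le> K\<^sup>2 * M\<^sup>2 * (M\<^sup>2 * (norm x)\<^sup>2 - (norm (bop_apply Y x))\<^sup>2)" for x
  proof -
    let ?w = "bop_apply Y (bop_apply Y x) - M\<^sup>2 *\<^sub>R x"
    have "x = bop_apply (Z * ((Y - M *\<^sub>R 1) * (Y + M *\<^sub>R 1))) x" by (simp only: Z) simp
    also have "\<dots> = bop_apply Z ?w" by (simp add: algebra_simps power2_eq_square)
    finally have "norm x \<le> K * norm ?w"
      using norm_bop_apply_le[of Z ?w] mult_right_mono[OF \<open>norm Z \<le> K\<close>, of "norm ?w"] by simp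
    then have "(norm x)\<^sup>2 \<le> K\<^sup>2 * (norm ?w)\<^sup>2"
      by (metis norm_ge_zero power_mono power_mult_distrib)
    also have "\<dots> \<le> K\<^sup>2 * (M\<^sup>2 * (M\<^sup>2 * (norm x)\<^sup>2 - (norm (bop_apply Y x))\<^sup>2))"
    proof (rule mult_left_mono)
      \<comment> \<open>Self-adjointness turns the cross term <Y^2 x, x> into |Yx|^2.\<close>
      have "(norm ?w)\<^sup>2 = (norm (bop_apply Y (bop_apply Y x)))\<^sup>2
          - 2 * M\<^sup>2 * (norm (bop_apply Y x))\<^sup>2 + M\<^sup>2 * M\<^sup>2 * (norm x)\<^sup>2"
        using selfadjoint_inner[OF assms(1), of "bop_apply Y x" x]
        by (simp add: power2_norm_eq_inner inner_diff_left inner_diff_right inner_commute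
            algebra_simps)
      also have "(norm (bop_apply Y (bop_apply Y x)))\<^sup>2 \<le> (M * norm (bop_apply Y x))\<^sup>2"
        by (simp add: M_def norm_bop_apply_le power_mono)
      finally show "(norm ?w)\<^sup>2 \<le> M\<^sup>2 * (M\<^sup>2 * (norm x)\<^sup>2 - (norm (bop_apply Y x))\<^sup>2)"
        by (simp add: power_mult_distrib algebra_simps)
    qed simp
    finally show ?thesis by (simp add: mult.assoc)
  qed
  \<comment> \<open>This is \<open>bound\<close> solved for |Yx|^2, which is then at most (M^2 -
    \<delta>)|x|^2.\<close>
  define \<delta> where "\<delta> = 1 / (K\<^sup>2 * M\<^sup>2)"
  have "\<delta> > 0" using \<open>K > 0\<close> \<open>M > 0\<close> by (simp add: \<delta>_def)
  define b where "b = sqrt (max 0 (M\<^sup>2 - \<delta>))"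
  have "norm Y \<le> b"
  proof (rule norm_bop_leI)
    fix x
    have "(norm (bop_apply Y x))\<^sup>2 \<le> (M\<^sup>2 - \<delta>) * (norm x)\<^sup>2"
      using bound[of x] \<open>K > 0\<close> \<open>M > 0\<close> by (simp add: \<delta>_def field_simps)
    also have "\<dots> \<le> (b * norm x)\<^sup>2"
      by (simp add: b_def power_mult_distrib mult_right_mono)
    finally show "norm (bop_apply Y x) \<le> b * norm x"
      by (rule power2_le_imp_le) (simp add: b_def)
  qed (simp add: b_def)
  moreover have "b < M"
    using \<open>\<delta> > 0\<close> \<open>M > 0\<close> unfolding b_def by (intro real_less_lsqrt) auto
  ultimately show False by (simp add: M_def)
qed

text \<open>The hypothesis \<open>1 \<noteq> 0\<close> excludes the zero space, whose only operator
  is invertible and has empty spectrum.\<close>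

lemma spectrum_nonempty:
  fixes X :: "'a::complex_hilbert bop"
  assumes "selfadjoint_op X" "(1 :: 'a bop) \<noteq> 0"
  obtains r where "complex_of_real r \<in> spectrum_op X"
proof (cases "X = 0")
  case True
  then have "complex_of_real 0 \<in> spectrum_op X"
    using assms(2) by (simp add: spectrum_op_def invertible_op_def)
  then show ?thesis by (rule that)
next
  case False
  then show ?thesis using norm_mem_spectrum[OF assms(1)] that by (metis zero_less_norm_iff)
qed

text \<open>For real r outside the interval, X - r or its negative is coercive with constant |r| -
  |X|.\<close>

lemma spectrum_le_norm:
  assumes "complex_of_real r \<in> spectrum_op X"
  shows "r \<in> {- norm X .. norm X}"
proof -
  have X: "\<bar>inner (bop_apply X x) x\<bar> \<le> norm X * (norm x)\<^sup>2" for x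
    using Cauchy_Schwarz_ineq2[of "bop_apply X x" x] mult_right_mono[OF norm_bop_apply_le[of X x], of "norm x"]
    by (simp add: power2_eq_square mult.assoc)
  have "invertible_op (X - complex_of_real r *\<^sub>C 1)" if "r < - norm X"
  proof (rule coercive_invertible[of "- norm X - r"])
    show "(- norm X - r) * (norm x)\<^sup>2 \<le> inner (bop_apply (X - complex_of_real r *\<^sub>C 1) x) x" for x
      using X[of x] by (simp flip: scaleR_scaleC add: inner_diff_left power2_norm_eq_inner algebra_simps)
  qed (use that in simp)
  moreover have "invertible_op ((- 1) *\<^sub>C (X - complex_of_real r *\<^sub>C 1))" if "norm X < r"
  proof (rule coercive_invertible[of "r - norm X"])
    show "(r - norm X) * (norm x)\<^sup>2 \<le> inner (bop_apply ((- 1) *\<^sub>C (X - complex_of_real r *\<^sub>C 1)) x) x" for x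
      using X[of x]
      by (simp flip: scaleR_scaleC add: scaleC_minus_left inner_diff_left power2_norm_eq_inner algebra_simps)
  qed (use that in simp)
  ultimately show ?thesis
    using assms by (force simp: spectrum_op_def invertible_op_scaleC)
qed

text \<open>For r < 0 positivity makes X - r coercive. For 0 \<le> r < a write X - r = X(1 - rZ)
  with Z the inverse of X; the second factor is coercive because r|Z| < 1. The uniform bound puts
  the spectrum into a compact part of the open half-line.\<close>

lemma strictly_positive_spectrum:
  assumes "strictly_positive_op X"
  obtains a where "a > 0" "\<And>r. complex_of_real r \<in> spectrum_op X \<Longrightarrow> a \<le> r"
proof -
  have "positive_op X" and inv: "invertible_op X" using assms by (auto simp: strictly_positive_op_def)
  then have pos: "0 \<le> inner (bop_apply X x) x" for x
    using positive_op_iff positive_op_selfadjoint by blast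
  obtain Z where Z: "X * Z = 1" "Z * X = 1" using inv by (auto simp: invertible_op_def)
  define a where "a = 1 / (norm Z + 1)"
  have "a > 0" by (simp add: a_def add_nonneg_pos)
  moreover have "a \<le> r" if r: "complex_of_real r \<in> spectrum_op X" for r
  proof (rule ccontr)
    assume "\<not> a \<le> r"
    have "invertible_op (X - complex_of_real r *\<^sub>C 1)"
    proof (cases "r < 0")
      case True
      show ?thesis
      proof (rule coercive_invertible[of "- r"])
        show "- r * (norm x)\<^sup>2 \<le> inner (bop_apply (X - complex_of_real r *\<^sub>C 1) x) x" for x
          using pos[of x]
          by (simp flip: scaleR_scaleC add: inner_diff_left power2_norm_eq_inner algebra_simps)
      qed (use True in simp)
    next
      case False
      have "r * norm Z < 1"
      proof -
        have "r * (norm Z + 1) < 1"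
          using \<open>\<not> a \<le> r\<close> by (simp add: a_def not_le pos_less_divide_eq add_nonneg_pos)
        then show ?thesis using False by (simp add: algebra_simps)
      qed
      have "invertible_op (1 - r *\<^sub>R Z)"
      proof (rule coercive_invertible[of "1 - r * norm Z"])
        fix x
        have "inner (bop_apply Z x) x \<le> norm Z * (norm x)\<^sup>2"
          using norm_cauchy_schwarz[of "bop_apply Z x" x] mult_right_mono[OF norm_bop_apply_le[of Z x], of "norm x"]
          by (simp add: power2_eq_square mult.assoc)
        then have "r * inner (bop_apply Z x) x \<le> r * (norm Z * (norm x)\<^sup>2)"
          using False by (intro mult_left_mono) auto
        then show "(1 - r * norm Z) * (norm x)\<^sup>2 \<le> inner (bop_apply (1 - r *\<^sub>R Z) x) x"
          by (simp add: inner_diff_left power2_norm_eq_inner algebra_simps)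
      qed (use \<open>r * norm Z < 1\<close> in simp)
      then have "invertible_op (X * (1 - r *\<^sub>R Z))" by (rule invertible_op_times[OF inv])
      then show ?thesis by (simp add: right_diff_distrib Z scaleR_scaleC[symmetric])
    qed
    then show False using r by (simp add: spectrum_op_def)
  qed
  ultimately show thesis by (rule that)
qed

section \<open>Polynomials of an operator\<close>

definition cpoly_op :: "complex poly \<Rightarrow> 'a::complex_hilbert bop \<Rightarrow> 'a bop"
  where "cpoly_op p X = (\<Sum>i\<le>degree p. coeff p i *\<^sub>C X ^ i)"

lemma cpoly_op_sum:
  assumes "degree p \<le> N"
  shows "cpoly_op p X = (\<Sum>i\<le>N. coeff p i *\<^sub>C X ^ i)"
  unfolding cpoly_op_def
  by (rule sum.mono_neutral_left) (use assms in \<open>auto simp: coeff_eq_0\<close>)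

lemma scaleC_sum_right: "c *\<^sub>C (\<Sum>i\<in>I. x i) = (\<Sum>i\<in>I. c *\<^sub>C x i)" for x :: "_ \<Rightarrow> 'a::complex_vector"
  by (induction I rule: infinite_finite_induct) (simp_all add: scaleC_zero_right scaleC_add_right)

lemma cpoly_op_0 [simp]: "cpoly_op 0 X = 0"
  by (simp add: cpoly_op_def)

lemma cpoly_op_add: "cpoly_op (p + q) X = cpoly_op p X + cpoly_op q X"
proof -
  let ?N = "max (degree p) (degree q)"
  have "degree (p + q) \<le> ?N" by (rule degree_add_le_max)
  then show ?thesis
    by (simp add: cpoly_op_sum[of _ ?N] scaleC_add_left sum.distrib)
qed

lemma cpoly_op_smult: "cpoly_op (smult c p) X = c *\<^sub>C cpoly_op p X"
  using degree_smult_le[of c p]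
  by (simp add: cpoly_op_sum[of _ "degree p"] scaleC_sum_right scaleC_scaleC)

lemma cpoly_op_pCons: "cpoly_op (pCons a p) X = a *\<^sub>C 1 + X * cpoly_op p X"
proof -
  have "cpoly_op (pCons a p) X = (\<Sum>i\<le>Suc (degree p). coeff (pCons a p) i *\<^sub>C X ^ i)"
    by (rule cpoly_op_sum) (rule degree_pCons_le)
  then show ?thesis
    by (simp add: sum.atMost_Suc_shift cpoly_op_def sum_distrib_left scaleC_times_right
        del: sum.atMost_Suc)
qed

text \<open>Multiplication by the variable is \<open>pCons 0\<close>. This case of multiplicativity
  lets the induction on the degree split off one root at a time.\<close>

lemma cpoly_op_linear_times: "cpoly_op ([:- z, 1:] * p) X = (X - z *\<^sub>C 1) * cpoly_op p X"
proof -
  have "[:- z, 1:] * p = smult (- z) p + pCons 0 p" by simp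
  then show ?thesis
    by (simp only: cpoly_op_add cpoly_op_smult cpoly_op_pCons)
      (simp add: scaleC_minus_left left_diff_distrib scaleC_times_left)
qed

text \<open>One half of the spectral mapping theorem: split \<open>p\<close> into linear factors.\<close>

lemma cpoly_op_invertible:
  assumes "p \<noteq> 0" "\<And>z. z \<in> spectrum_op X \<Longrightarrow> poly p z \<noteq> 0"
  shows "invertible_op (cpoly_op p X)"
  using assms
proof (induction "degree p" arbitrary: p)
  case 0
  then obtain c where "p = [:c:]" by (metis degree_eq_zeroE)
  moreover have "invertible_op (1 :: 'a bop)" by (auto simp: invertible_op_def)
  ultimately show ?case using \<open>p \<noteq> 0\<close> by (simp add: cpoly_op_pCons invertible_op_scaleC)
next
  case (Suc n)
  then have "\<not> constant (poly p)" by (simp add: constant_degree)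
  then obtain z where z: "poly p z = 0" using fundamental_theorem_of_algebra by blast
  then obtain r where r: "p = [:- z, 1:] * r" by (auto simp: poly_eq_0_iff_dvd dvd_def)
  have "r \<noteq> 0" using r Suc.prems(1) by auto
  have "n = degree r" using r \<open>r \<noteq> 0\<close> Suc.hyps(2) by (subst (asm) r, subst (asm) degree_mult_eq) auto
  moreover have "poly r w \<noteq> 0" if "w \<in> spectrum_op X" for w
    using Suc.prems(2)[OF that] r by auto
  ultimately have "invertible_op (cpoly_op r X)" using Suc.hyps(1) \<open>r \<noteq> 0\<close> by blast
  moreover have "invertible_op (X - z *\<^sub>C 1)" using Suc.prems(2) z by (auto simp: spectrum_op_def)
  ultimately show ?case by (simp only: r cpoly_op_linear_times invertible_op_times)
qed

section \<open>Real polynomials: self-adjointness, norm bound and lower bound\<close>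

lemma poly_op_eq_cpoly_op: "poly_op p X = cpoly_op (map_poly complex_of_real p) X"
  by (simp add: poly_op_def cpoly_op_def degree_map_poly coeff_map_poly scaleR_scaleC)

lemma poly_op_sum:
  assumes "degree p \<le> N"
  shows "poly_op p X = (\<Sum>i\<le>N. coeff p i *\<^sub>R X ^ i)"
  unfolding poly_op_def
  by (rule sum.mono_neutral_left) (use assms in \<open>auto simp: coeff_eq_0\<close>)

lemma poly_op_diff: "poly_op (p - q) X = poly_op p X - poly_op q X"
proof -
  let ?N = "max (degree p) (degree q)"
  have "degree (p - q) \<le> ?N" by (rule degree_diff_le_max)
  then show ?thesis
    by (simp add: poly_op_sum[of _ ?N] scaleR_diff_left sum_subtractf)
qed

lemma poly_op_const [simp]: "poly_op [:c:] X = c *\<^sub>R 1"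
  by (simp add: poly_op_def)

lemma selfadjoint_op_diff:
  "selfadjoint_op X \<Longrightarrow> selfadjoint_op Y \<Longrightarrow> selfadjoint_op (X - Y)"
  by (simp add: selfadjoint_iff_inner inner_diff_left inner_diff_right)

lemma selfadjoint_op_power:
  assumes "selfadjoint_op X"
  shows "selfadjoint_op (X ^ n)"
proof (induction n)
  case (Suc n)
  have "inner (bop_apply (X ^ Suc n) x) y = inner x (bop_apply (X ^ n * X) y)" for x y
    using Suc assms by (simp add: selfadjoint_iff_inner)
  then show ?case by (simp add: selfadjoint_iff_inner flip: power_Suc2)
qed (simp add: selfadjoint_iff_inner)

lemma selfadjoint_op_sum:
  "(\<And>i. i \<in> I \<Longrightarrow> selfadjoint_op (X i)) \<Longrightarrow> selfadjoint_op (\<Sum>i\<in>I. X i)"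
  by (induction I rule: infinite_finite_induct)
    (simp_all add: selfadjoint_iff_inner inner_add_left inner_add_right)

lemma selfadjoint_poly_op:
  assumes "selfadjoint_op X"
  shows "selfadjoint_op (poly_op p X)"
proof -
  have "selfadjoint_op (c *\<^sub>R X ^ i)" for c i
    using selfadjoint_op_power[OF assms] by (simp add: selfadjoint_iff_inner)
  then show ?thesis by (simp add: poly_op_def selfadjoint_op_sum)
qed

lemma poly_map_poly_of_real:
  "poly (map_poly complex_of_real p) (complex_of_real r) = complex_of_real (poly p r)"
  by (induction p) (simp_all add: map_poly_pCons)

abbreviation real_spectrum :: "'a::complex_hilbert bop \<Rightarrow> real set"
  where "real_spectrum X \<equiv> {r. complex_of_real r \<in> spectrum_op X}"

text \<open>The operator q(X) has its norm, up to sign, as a spectral value, and by spectral mapping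
  this is a value of q on the spectrum of X. The hypothesis \<open>c \<ge> 0\<close> covers the zero
  space, where the bound over the spectrum is vacuous.\<close>

lemma norm_poly_op_le:
  fixes X :: "'a::complex_hilbert bop"
  assumes X: "selfadjoint_op X" and "c \<ge> 0"
    and le: "\<And>r. r \<in> real_spectrum X \<Longrightarrow> \<bar>poly q r\<bar> \<le> c"
  shows "norm (poly_op q X) \<le> c"
proof (rule ccontr)
  define Y where "Y = poly_op q X"
  assume "\<not> ?thesis"
  then have "c < norm Y" by (simp add: Y_def)
  then have "norm Y > 0" using \<open>c \<ge> 0\<close> by linarith
  then have "(1 :: 'a bop) \<noteq> 0" by (metis mult_1_right mult_zero_right norm_zero less_irrefl)
  obtain \<sigma> where \<sigma>: "\<bar>\<sigma>\<bar> = norm Y" "complex_of_real \<sigma> \<in> spectrum_op Y"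
    using norm_mem_spectrum[OF _ \<open>norm Y > 0\<close>] selfadjoint_poly_op[OF X, of q]
    by (metis Y_def abs_minus_cancel abs_norm_cancel)
  define p where "p = map_poly complex_of_real (q - [:\<sigma>:])"
  have "cpoly_op p X = Y - complex_of_real \<sigma> *\<^sub>C 1"
    by (simp add: p_def Y_def poly_op_diff scaleR_scaleC flip: poly_op_eq_cpoly_op)
  then have not_inv: "\<not> invertible_op (cpoly_op p X)"
    using \<sigma>(2) by (simp add: spectrum_op_def)
  have "\<exists>r\<in>real_spectrum X. poly q r = \<sigma>"
  proof (cases "p = 0")
    \<comment> \<open>Here q is the constant \<open>\<sigma>\<close>, so every spectral value of X
      serves.\<close>
    case True
    then have "q - [:\<sigma>:] = 0"
      by (simp add: p_def map_poly_eq_0_iff)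
    then show ?thesis
      using spectrum_nonempty[OF X \<open>1 \<noteq> 0\<close>] by auto
  next
    case False
    then obtain z where z: "z \<in> spectrum_op X" "poly p z = 0"
      using cpoly_op_invertible not_inv by blast
    then have "z = complex_of_real (Re z)"
      using selfadjoint_spectrum_real[OF X] by (simp add: complex_eq_iff)
    moreover have "poly p (complex_of_real r) = complex_of_real (poly q r - \<sigma>)" for r
      by (simp add: p_def poly_map_poly_of_real)
    ultimately show ?thesis using z by (metis (no_types, lifting) eq_iff_diff_eq_0 mem_Collect_eq of_real_eq_0_iff)
  qed
  then show False using le \<sigma>(1) \<open>c < norm Y\<close> by fastforce
qed

text \<open>On the spectrum q takes values in [-e, M]. Subtracting the midpoint c leaves a
  polynomial bounded by the radius (M + e)/2, so the norm bound applies, and c - (M + e)/2 =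
  -e.\<close>

lemma poly_op_lower_bound:
  assumes X: "selfadjoint_op X"
    and ge: "\<And>r. r \<in> real_spectrum X \<Longrightarrow> - e \<le> poly q r"
  shows "- e * (norm x)\<^sup>2 \<le> inner (bop_apply (poly_op q X) x) x"
proof -
  have "bounded (poly q ` {- norm X .. norm X})"
    by (intro compact_imp_bounded compact_continuous_image continuous_intros) auto
  then obtain M0 where "\<And>r. r \<in> {- norm X .. norm X} \<Longrightarrow> \<bar>poly q r\<bar> \<le> M0"
    by (force simp: bounded_iff)
  then have M0: "\<bar>poly q r\<bar> \<le> M0" if "r \<in> real_spectrum X" for r
    using spectrum_le_norm[of r X] that by auto
  \<comment> \<open>The maximum with \<open>\<bar>e\<bar>\<close> makes the radius
    \<open>(M + e) / 2\<close> nonnegative.\<close>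
  define M where "M = max M0 \<bar>e\<bar>"
  define c where "c = (M - e) / 2"
  have M: "\<bar>poly q r\<bar> \<le> M" if "r \<in> real_spectrum X" for r
    using M0[OF that] by (simp add: M_def)
  have "norm (poly_op (q - [:c:]) X) \<le> (M + e) / 2"
  proof (rule norm_poly_op_le[OF X])
    show "\<bar>poly (q - [:c:]) r\<bar> \<le> (M + e) / 2" if "r \<in> real_spectrum X" for r
      using M[OF that] ge[OF that] by (simp add: c_def field_simps abs_le_iff)
  qed (simp add: M_def)
  then have "norm (bop_apply (poly_op (q - [:c:]) X) x) \<le> (M + e) / 2 * norm x"
    by (metis norm_bop_apply_le order_trans mult_right_mono norm_ge_zero)
  then have "\<bar>inner (bop_apply (poly_op (q - [:c:]) X) x) x\<bar> \<le> (M + e) / 2 * norm x * norm x"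
    by (meson Cauchy_Schwarz_ineq2 order_trans mult_right_mono norm_ge_zero)
  moreover have inner_eq: "inner (bop_apply (poly_op (q - [:c:]) X) x) x
      = inner (bop_apply (poly_op q X) x) x - c * (norm x)\<^sup>2"
    by (simp add: poly_op_diff inner_diff_left power2_norm_eq_inner)
  ultimately have "- ((M + e) / 2 * (norm x)\<^sup>2) \<le> inner (bop_apply (poly_op q X) x) x - c * (norm x)\<^sup>2"
    unfolding inner_eq abs_le_iff by (simp add: power2_eq_square mult.assoc)
  then show ?thesis by (simp add: c_def field_simps)
qed

section \<open>The continuous functional calculus\<close>

text \<open>The predicate under the description operator in \<open>fun_op\<close>. Self-adjointness
  and monotonicity are proved for every operator satisfying it, so that uniqueness can be derived
  from them.\<close>

abbreviation is_fun_op :: "(real \<Rightarrow> real) \<Rightarrow> 'a::complex_hilbert bop \<Rightarrow> 'a bop \<Rightarrow> bool"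
  where "is_fun_op f X Y \<equiv> \<exists>p. uniform_limit (real_spectrum X) (\<lambda>n. poly (p n)) f sequentially
    \<and> (\<lambda>n. poly_op (p n) X) \<longlonglongrightarrow> Y"

lemma is_fun_op_const: "is_fun_op (\<lambda>_. c) X (c *\<^sub>R 1)"
  by (rule exI[of _ "\<lambda>_. [:c:]"]) (simp add: uniform_limit_iff)

lemma is_fun_op_selfadjoint:
  assumes X: "selfadjoint_op X" and "is_fun_op f X Y"
  shows "selfadjoint_op Y"
proof -
  obtain p where p: "(\<lambda>n. poly_op (p n) X) \<longlonglongrightarrow> Y" using assms(2) by blast
  have "inner (bop_apply Y x) y = inner x (bop_apply Y y)" for x y
  proof (rule LIMSEQ_unique)
    show "(\<lambda>n. inner (bop_apply (poly_op (p n) X) x) y) \<longlonglongrightarrow> inner (bop_apply Y x) y"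
      by (intro tendsto_intros tendsto_bop_apply p)
    show "(\<lambda>n. inner (bop_apply (poly_op (p n) X) x) y) \<longlonglongrightarrow> inner x (bop_apply Y y)"
      unfolding selfadjoint_inner[OF selfadjoint_poly_op[OF X]]
      by (intro tendsto_intros tendsto_bop_apply p)
  qed
  then show ?thesis by (simp add: selfadjoint_iff_inner)
qed

text \<open>The approximating polynomials need not be ordered, but for large n the difference
  \<open>q n - p n\<close> is at least -e on the spectrum. The resulting lower bound survives the
  limit in n, and then e tends to 0.\<close>

lemma is_fun_op_mono:
  assumes X: "selfadjoint_op X" and "is_fun_op f X Y" and "is_fun_op g X Z"
    and le: "\<And>r. r \<in> real_spectrum X \<Longrightarrow> f r \<le> g r"
  shows "inner (bop_apply Y x) x \<le> inner (bop_apply Z x) x"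
proof -
  obtain p where p: "uniform_limit (real_spectrum X) (\<lambda>n. poly (p n)) f sequentially"
      "(\<lambda>n. poly_op (p n) X) \<longlonglongrightarrow> Y"
    using assms(2) by blast
  obtain q where q: "uniform_limit (real_spectrum X) (\<lambda>n. poly (q n)) g sequentially"
      "(\<lambda>n. poly_op (q n) X) \<longlonglongrightarrow> Z"
    using assms(3) by blast
  have ev: "- e * (norm x)\<^sup>2 \<le> inner (bop_apply (Z - Y) x) x" if "e > 0" for e
  proof (rule tendsto_lowerbound)
    show "(\<lambda>n. inner (bop_apply (poly_op (q n) X - poly_op (p n) X) x) x)
        \<longlonglongrightarrow> inner (bop_apply (Z - Y) x) x"
      by (intro tendsto_intros tendsto_bop_apply p q)
    have "e / 2 > 0" using that by simp
    from uniform_limitD[OF p(1) this] uniform_limitD[OF q(1) this]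
    show "\<forall>\<^sub>F n in sequentially.
        - e * (norm x)\<^sup>2 \<le> inner (bop_apply (poly_op (q n) X - poly_op (p n) X) x) x"
    proof eventually_elim
      case (elim n)
      have "- e \<le> poly (q n - p n) r" if "r \<in> real_spectrum X" for r
        using bspec[OF elim(1) that] bspec[OF elim(2) that] le[OF that]
        by (simp add: dist_real_def abs_if split: if_splits)
      then show ?case using poly_op_lower_bound[OF X, of e "q n - p n" x] by (simp only: poly_op_diff)
    qed
  qed simp
  have "0 \<le> inner (bop_apply (Z - Y) x) x"
  proof (rule field_le_epsilon)
    fix d :: real assume "d > 0"
    have n: "(norm x)\<^sup>2 + 1 > 0" by (simp add: add_nonneg_pos)
    \<comment> \<open>Adding 1 to the denominator allows \<open>x = 0\<close>.\<close>
    have "d / ((norm x)\<^sup>2 + 1) * (norm x)\<^sup>2 \<le> d"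
      using \<open>d > 0\<close> n by (simp add: divide_simps)
    then show "0 \<le> inner (bop_apply (Z - Y) x) x + d"
      using ev[of "d / ((norm x)\<^sup>2 + 1)"] \<open>d > 0\<close> n by (simp add: divide_pos_pos)
  qed
  then show ?thesis by (simp add: inner_diff_left)
qed

text \<open>Monotonicity in both directions makes the quadratic form of the difference D vanish.
  Since D is self-adjoint, its form at x + Dx reduces to 2|Dx|^2, so Dx = 0.\<close>

lemma is_fun_op_unique:
  assumes X: "selfadjoint_op X" and Y: "is_fun_op f X Y" and Z: "is_fun_op f X Z"
  shows "Y = Z"
proof (rule bop_eqI)
  fix x
  define D where "D = Y - Z"
  have D: "inner (bop_apply D u) v = inner u (bop_apply D v)" for u v
    using selfadjoint_op_diff[OF is_fun_op_selfadjoint[OF X Y] is_fun_op_selfadjoint[OF X Z]]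
    by (simp add: selfadjoint_iff_inner D_def)
  have form: "inner (bop_apply D u) u = 0" for u
    using is_fun_op_mono[OF X Y Z, of u] is_fun_op_mono[OF X Z Y, of u]
    by (simp add: D_def inner_diff_left)
  have "inner (bop_apply D x) (bop_apply D x) = 0"
    using form[of "x + bop_apply D x"] form[of x] form[of "bop_apply D x"]
      D[of "bop_apply D x" x]
    by (simp add: inner_add_left inner_add_right)
  then show "bop_apply Y x = bop_apply Z x" by (simp add: D_def)
qed

text \<open>Weierstrass approximation on the interval supplies the polynomials; the norm bound by
  the supremum over the spectrum makes their values at X a Cauchy sequence.\<close>

lemma is_fun_op_exists:
  assumes X: "selfadjoint_op X" and S: "real_spectrum X \<subseteq> {a..b}" and f: "continuous_on {a..b} f"
  shows "\<exists>Y. is_fun_op f X Y"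
proof -
  have "\<exists>p. \<forall>r\<in>{a..b}. \<bar>f r - poly p r\<bar> < 1 / Suc n" for n
  proof -
    obtain h where h: "real_polynomial_function h" "\<And>r. r \<in> {a..b} \<Longrightarrow> \<bar>f r - h r\<bar> < 1 / Suc n"
      using Stone_Weierstrass_real_polynomial_function[of "{a..b}" f "1 / Suc n"] f by auto
    then obtain c m where "h = (\<lambda>x. \<Sum>i\<le>m. c i * x ^ i)"
      by (auto simp: real_polynomial_function_iff_sum)
    then have h_eq: "h r = poly (\<Sum>i\<le>m. monom (c i) i) r" for r
      by (simp add: poly_sum poly_monom)
    show ?thesis using h(2) unfolding h_eq by blast
  qed
  then obtain p where p: "\<And>n r. r \<in> {a..b} \<Longrightarrow> \<bar>f r - poly (p n) r\<bar> < 1 / Suc n"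
    by metis
  have lim: "uniform_limit (real_spectrum X) (\<lambda>n. poly (p n)) f sequentially"
  proof (rule uniform_limitI)
    fix e :: real assume "e > 0"
    then obtain N where N: "1 / Suc N < e" using nat_approx_posE by auto
    show "\<forall>\<^sub>F n in sequentially. \<forall>r\<in>real_spectrum X. dist (poly (p n) r) (f r) < e"
    proof (rule eventually_sequentiallyI[of N], intro ballI)
      fix n r assume "N \<le> n" "r \<in> real_spectrum X"
      then have "\<bar>f r - poly (p n) r\<bar> < 1 / Suc n" using S by (intro p) auto
      also have "\<dots> \<le> 1 / Suc N" using \<open>N \<le> n\<close> by (simp add: frac_le)
      finally show "dist (poly (p n) r) (f r) < e" using N by (simp add: dist_real_def abs_minus_commute)
    qed
  qed
  have "Cauchy (\<lambda>n. poly_op (p n) X)"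
  proof (rule metric_CauchyI)
    fix e :: real assume "e > 0"
    \<comment> \<open>Two errors of e/4 give the non-strict norm bound e/2, which is strictly below
      e.\<close>
    then have "e / 4 > 0" by simp
    from uniform_limitD[OF lim this] obtain N where
      N: "\<And>n r. n \<ge> N \<Longrightarrow> r \<in> real_spectrum X \<Longrightarrow> dist (poly (p n) r) (f r) < e / 4"
      by (auto simp: eventually_sequentially)
    have "dist (poly_op (p m) X) (poly_op (p n) X) < e" if "m \<ge> N" "n \<ge> N" for m n
    proof -
      have "norm (poly_op (p m - p n) X) \<le> e / 2"
      proof (rule norm_poly_op_le[OF X])
        show "\<bar>poly (p m - p n) r\<bar> \<le> e / 2" if "r \<in> real_spectrum X" for r
          using N[OF \<open>m \<ge> N\<close> that] N[OF \<open>n \<ge> N\<close> that]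
          by (simp add: dist_real_def abs_if split: if_splits)
      qed (use \<open>e > 0\<close> in simp)
      then show ?thesis using \<open>e > 0\<close> by (simp add: poly_op_diff dist_norm)
    qed
    then show "\<exists>M. \<forall>m\<ge>M. \<forall>n\<ge>M. dist (poly_op (p m) X) (poly_op (p n) X) < e" by blast
  qed
  then obtain Y where "(\<lambda>n. poly_op (p n) X) \<longlonglongrightarrow> Y"
    using Cauchy_convergent_iff convergent_def by blast
  then show ?thesis using lim by blast
qed

lemma is_fun_op_fun_op:
  assumes "selfadjoint_op X" "real_spectrum X \<subseteq> {a..b}" "continuous_on {a..b} f"
  shows "is_fun_op f X (fun_op f X)"
  unfolding fun_op_def
  by (rule theI'[of "is_fun_op f X"]) (use is_fun_op_exists[OF assms] is_fun_op_unique[OF assms(1)] in blast)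

text \<open>The spectrum lies in \<open>{a..norm X}\<close> with \<open>a > 0\<close>, so continuity
  on the open half-line suffices for functions such as real powers.\<close>

lemma strictly_positive_is_fun_op:
  assumes X: "strictly_positive_op X" and f: "continuous_on {0<..} f"
  shows "is_fun_op f X (fun_op f X)"
proof -
  obtain a where a: "a > 0" "\<And>r. r \<in> real_spectrum X \<Longrightarrow> a \<le> r"
    using strictly_positive_spectrum[OF X] by auto
  show ?thesis
  proof (rule is_fun_op_fun_op)
    show "selfadjoint_op X" using X by (rule strictly_positive_selfadjoint)
    show "real_spectrum X \<subseteq> {a..norm X}"
      using a(2) spectrum_le_norm[of _ X] by auto
    show "continuous_on {a..norm X} f"
      by (rule continuous_on_subset[OF f]) (use a(1) in auto)
  qed
qed

section \<open>Tsallis relative operator entropy\<close>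

lemma continuous_on_powr_const: "continuous_on {0<..} (\<lambda>x. x powr a)" for a :: real
  by (auto intro!: continuous_intros)

lemma selfadjoint_powr_op:
  "strictly_positive_op X \<Longrightarrow> selfadjoint_op (powr_op X a)"
  unfolding powr_op_def
  using is_fun_op_selfadjoint[OF strictly_positive_selfadjoint strictly_positive_is_fun_op] continuous_on_powr_const
  by blast

text \<open>The power function is monotone, hence bounded below on the spectrum by its smaller
  endpoint value m > 0. Comparison with the constant function m makes the operator coercive.\<close>

lemma invertible_powr_op:
  assumes X: "strictly_positive_op X"
  shows "invertible_op (powr_op X a)"
proof -
  obtain c where c: "c > 0" "\<And>r. r \<in> real_spectrum X \<Longrightarrow> c \<le> r"
    using strictly_positive_spectrum[OF X] by auto
  \<comment> \<open>The maximum with \<open>c\<close> keeps the base positive even if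
    \<open>norm X\<close> is 0.\<close>
  define m where "m = min (c powr a) ((max c (norm X)) powr a)"
  have "m > 0" using c(1) by (simp add: m_def)
  show ?thesis
  proof (rule coercive_invertible[OF \<open>m > 0\<close>])
    have "m \<le> r powr a" if "r \<in> real_spectrum X" for r
    proof (cases "a \<ge> 0")
      case True
      then have "c powr a \<le> r powr a" using c(1) c(2)[OF that] by (intro powr_mono2) auto
      then show ?thesis by (simp add: m_def)
    next
      case False
      then have "(max c (norm X)) powr a \<le> r powr a"
        using c(1) c(2)[OF that] spectrum_le_norm[of r X] that by (intro powr_mono2') auto
      then show ?thesis by (simp add: m_def)
    qed
    then have "inner (bop_apply (m *\<^sub>R 1) x) x \<le> inner (bop_apply (powr_op X a) x) x" for x
      unfolding powr_op_def
      by (intro is_fun_op_mono[OF strictly_positive_selfadjoint[OF X] is_fun_op_const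
            strictly_positive_is_fun_op[OF X continuous_on_powr_const]])
    then show "m * (norm x)\<^sup>2 \<le> inner (bop_apply (powr_op X a) x) x" for x
      by (simp add: power2_norm_eq_inner)
  qed
qed

lemma selfadjoint_sandwich:
  "selfadjoint_op P \<Longrightarrow> selfadjoint_op X \<Longrightarrow> selfadjoint_op (P * X * P)"
  by (simp add: selfadjoint_iff_inner)

text \<open>The quadratic form of \<open>P * X * P\<close> at x is that of \<open>X\<close> at
  Px.\<close>

lemma strictly_positive_sandwich:
  assumes P: "selfadjoint_op P" "invertible_op P" and X: "strictly_positive_op X"
  shows "strictly_positive_op (P * X * P)"
  unfolding strictly_positive_op_def
proof
  have "0 \<le> inner (bop_apply X y) y" for y
    using X positive_op_iff[OF strictly_positive_selfadjoint[OF X]]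
    by (simp add: strictly_positive_op_def)
  then show "positive_op (P * X * P)"
    using selfadjoint_inner[OF P(1)]
    by (subst positive_op_iff[OF selfadjoint_sandwich[OF P(1) strictly_positive_selfadjoint[OF X]]]) simp
  show "invertible_op (P * X * P)"
    using P(2) X by (simp add: invertible_op_times strictly_positive_op_def)
qed

text \<open>Young's inequality for x^s and 1 with weights t/s and 1 - t/s gives x^t - 1 \<le>
  (t/s)(x^s - 1); then divide by t.\<close>

lemma ln_tsallis_mono:
  assumes "0 < t" "t \<le> s" "x > 0"
  shows "ln_tsallis t x \<le> ln_tsallis s x"
proof -
  have "(x powr s) powr (t / s) * 1 powr (1 - t / s) \<le> t / s * x powr s + (1 - t / s) * 1"
    by (rule Youngs_inequality_0) (use assms in auto)
  then have "x powr t - 1 \<le> t / s * (x powr s - 1)"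
    using assms by (simp add: powr_powr algebra_simps)
  then show ?thesis
    using assms by (simp add: ln_tsallis_def field_simps)
qed

theorem theorem2p8:
  fixes A B :: "'h::complex_hilbert bop" and s t :: real
  assumes "strictly_positive_op A" and "strictly_positive_op B"
    and "0 < t" and "t \<le> s" and "s \<le> 1"
  shows "tsallis_entropy t A B \<preceq> tsallis_entropy s A B"
proof -
  define P where "P = powr_op A (1/2)"
  define C where "C = powr_op A (- (1/2)) * B * powr_op A (- (1/2))"
  have P: "selfadjoint_op P" unfolding P_def by (rule selfadjoint_powr_op[OF assms(1)])
  have C: "strictly_positive_op C"
    unfolding C_def using assms by (intro strictly_positive_sandwich selfadjoint_powr_op invertible_powr_op)
  have F: "is_fun_op (ln_tsallis u) C (fun_op (ln_tsallis u) C)" if "u > 0" for u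
    by (rule strictly_positive_is_fun_op[OF C])
      (use that in \<open>auto simp: ln_tsallis_def intro!: continuous_intros\<close>)
  \<comment> \<open>The order \<open>\<preceq>\<close> includes self-adjointness of both
    sides.\<close>
  have sa: "selfadjoint_op (tsallis_entropy u A B)" if "u > 0" for u
    unfolding tsallis_entropy_def C_def[symmetric] P_def[symmetric]
    by (rule selfadjoint_sandwich[OF P is_fun_op_selfadjoint[OF strictly_positive_selfadjoint[OF C] F[OF that]]])
  obtain a where a: "a > 0" "\<And>r. r \<in> real_spectrum C \<Longrightarrow> a \<le> r"
    using strictly_positive_spectrum[OF C] by auto
  have "s > 0" using assms by simp
  have mono: "inner (bop_apply (fun_op (ln_tsallis t) C) y) y
      \<le> inner (bop_apply (fun_op (ln_tsallis s) C) y) y" for y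
  proof (rule is_fun_op_mono[OF strictly_positive_selfadjoint[OF C] F[OF \<open>0 < t\<close>] F[OF \<open>0 < s\<close>]])
    show "ln_tsallis t r \<le> ln_tsallis s r" if "r \<in> real_spectrum C" for r
      using a(1) a(2)[OF that] by (intro ln_tsallis_mono assms(3,4)) simp
  qed
  \<comment> \<open>As \<open>P\<close> is self-adjoint, the form at x is that of the difference of
    the two functions of \<open>C\<close> at Px.\<close>
  have "0 \<le> inner (bop_apply (tsallis_entropy s A B - tsallis_entropy t A B) x) x" for x
    using mono[of "bop_apply P x"] selfadjoint_inner[OF P]
    by (simp add: tsallis_entropy_def inner_diff_left flip: C_def P_def)
  then show ?thesis
    using sa[OF \<open>0 < t\<close>] sa[OF \<open>0 < s\<close>]
    by (simp add: le_op_def positive_op_iff selfadjoint_op_diff)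
qed

end
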